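(* Suppose that $\diamondsuit$ holds. Then there is a partition $[\omega_1]^2=\bigcup_{n<\omega}G_n$ such that each $G_n$ is a triangle-free Hajnal-Máté graph with uncountable chromatic number.
   Context: $[\omega_1]^2$ is the set of two-element subsets of $\omega_1$. A set $G\subseteq[\omega_1]^2$ is regarded as the edge set of a graph with vertex set $\omega_1$. For $\alpha<\omega_1$, let $G(\alpha)=\{\beta<\alpha\mid\{\beta,\alpha\}\in G\}$. A graph $G\subseteq[\omega_1]^2$ is a Hajnal-Máté graph if, for every $\alpha<\omega_1$, $G(\alpha)$ is either a finite set or an $\omega$-sequence converging to $\alpha$ (i.e. a set of order type $\omega$ with supremum $\alpha$). $\diamondsuit$ is Jensen's diamond principle on $\omega_1$. *)

theory Defs
  imports
    Main
    "HOL-Library.Ramsey"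
    "HOL-Library.Lub_Glb"
    "HOL-Library.Disjoint_Sets"
    "HOL-Library.Countable_Set_Type"
begin

unbundle cardinal_syntax

text \<open>The elements of the type \<open>omega1\<close> are the ordinals below \<open>\<omega>\<^sub>1\<close>: \<open>cardSuc natLeq\<close> is a
  well-order of cardinality \<open>\<aleph>\<^sub>1\<close> all of whose proper initial segments are countable.  The lemmas
  \<open>countable_lessThan_omega1\<close> and \<open>uncountable_omega1\<close> characterise it up to isomorphism.\<close>

lemma Field_cardSuc_natLeq_nonempty: "Field (cardSuc natLeq) \<noteq> {}"
  by (metis Field_natLeq UNIV_not_empty cardSuc_greater natLeq_Card_order card_of_empty3
      card_of_Field_ordIso cardSuc_Card_order card_of_ordIso_finite cardSuc_finite finite.emptyI
      infinite_UNIV_nat)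

typedef omega1 = "Field (cardSuc natLeq)"
  using Field_cardSuc_natLeq_nonempty by blast

lemma Well_order_cardSuc_natLeq: "Well_order (cardSuc natLeq)"
  using cardSuc_Card_order[OF natLeq_Card_order] card_order_on_well_order_on by blast

instantiation omega1 :: wellorder
begin

definition less_eq_omega1 :: "omega1 \<Rightarrow> omega1 \<Rightarrow> bool" where
  "\<alpha> \<le> \<beta> \<longleftrightarrow> (Rep_omega1 \<alpha>, Rep_omega1 \<beta>) \<in> cardSuc natLeq"

definition less_omega1 :: "omega1 \<Rightarrow> omega1 \<Rightarrow> bool" where
  "\<alpha> < \<beta> \<longleftrightarrow> \<alpha> \<le> \<beta> \<and> \<not> \<beta> \<le> (\<alpha> :: omega1)"

instance
proof
  note wo = Well_order_cardSuc_natLeq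
  have refl: "refl_on (Field (cardSuc natLeq)) (cardSuc natLeq)"
    and trans: "trans (cardSuc natLeq)" and antisym: "antisym (cardSuc natLeq)"
    and total: "total_on (Field (cardSuc natLeq)) (cardSuc natLeq)"
    and wf: "wf (cardSuc natLeq - Id)"
    using wo unfolding well_order_on_def linear_order_on_def partial_order_on_def preorder_on_def
    by auto
  fix x y z :: omega1
  show "x < y \<longleftrightarrow> x \<le> y \<and> \<not> y \<le> x"
    by (simp add: less_omega1_def)
  show "x \<le> x"
    using refl Rep_omega1 by (auto simp: less_eq_omega1_def refl_on_def)
  show "x \<le> y \<Longrightarrow> y \<le> z \<Longrightarrow> x \<le> z"
    using trans by (auto simp: less_eq_omega1_def dest: transD)
  show anti: "x \<le> y \<Longrightarrow> y \<le> x \<Longrightarrow> x = y" for x y :: omega1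
    using antisym by (auto simp: less_eq_omega1_def Rep_omega1_inject dest: antisymD)
  show "x \<le> y \<or> y \<le> x"
    using total refl Rep_omega1[of x] Rep_omega1[of y]
    by (cases "Rep_omega1 x = Rep_omega1 y")
      (auto simp: less_eq_omega1_def total_on_def refl_on_def)
  fix P :: "omega1 \<Rightarrow> bool" and a :: omega1
  assume step: "\<And>x. (\<And>y. y < x \<Longrightarrow> P y) \<Longrightarrow> P x"
  have "wf (inv_image (cardSuc natLeq - Id) Rep_omega1)"
    using wf by (rule wf_inv_image)
  moreover have "inv_image (cardSuc natLeq - Id) Rep_omega1 = {(x, y). x < y}"
    by (auto simp: inv_image_def less_omega1_def less_eq_omega1_def Rep_omega1_inject
        dest: antisymD[OF antisym])
  ultimately have "wf {(x, y). x < (y :: omega1)}" by simp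
  then show "P a"
    by (induction a rule: wf_induct_rule) (auto intro: step)
qed

end

lemma countable_lessThan_omega1: "countable {..<(\<alpha> :: omega1)}"
proof -
  let ?r = "cardSuc natLeq"
  have "Rep_omega1 ` {..<\<alpha>} \<subseteq> underS ?r (Rep_omega1 \<alpha>)"
    by (auto simp: underS_def less_omega1_def less_eq_omega1_def Rep_omega1_inject)
  moreover have "|underS ?r (Rep_omega1 \<alpha>)| <o ?r"
    using cardSuc_Card_order[OF natLeq_Card_order] Rep_omega1 by (rule card_of_underS)
  then have "countable (underS ?r (Rep_omega1 \<alpha>))"
    using cardSuc_ordLeq_ordLess[OF natLeq_Card_order card_of_Card_order]
    unfolding countable_card_le_natLeq by blast
  ultimately have "countable (Rep_omega1 ` {..<\<alpha>})"
    by (rule countable_subset)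
  then show ?thesis
    by (rule countable_image_inj_on) (simp add: inj_on_def Rep_omega1_inject)
qed

lemma uncountable_omega1: "uncountable (UNIV :: omega1 set)"
proof
  assume "countable (UNIV :: omega1 set)"
  then have "countable (range Rep_omega1)" by simp
  then have "countable (Field (cardSuc natLeq))"
    using type_definition.Rep_range[OF type_definition_omega1] by simp
  then have "cardSuc natLeq \<le>o natLeq"
    using card_of_Field_ordIso[OF cardSuc_Card_order[OF natLeq_Card_order]]
      ordIso_ordLeq_trans ordIso_symmetric
    unfolding countable_card_le_natLeq by blast
  then show False
    using cardSuc_greater[OF natLeq_Card_order] not_ordLess_ordLeq by blast
qed

definition club :: "omega1 set \<Rightarrow> bool" where
  "club C \<longleftrightarrow>
     (\<forall>\<alpha>. \<exists>\<beta>\<in>C. \<alpha> < \<beta>) \<and>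
     (\<forall>S \<alpha>. S \<subseteq> C \<and> S \<noteq> {} \<and> isLub UNIV S \<alpha> \<longrightarrow> \<alpha> \<in> C)"

definition stationary :: "omega1 set \<Rightarrow> bool" where
  "stationary S \<longleftrightarrow> (\<forall>C. club C \<longrightarrow> S \<inter> C \<noteq> {})"

definition diamond :: bool where
  "diamond \<longleftrightarrow>
     (\<exists>A :: omega1 \<Rightarrow> omega1 set.
        (\<forall>\<alpha>. A \<alpha> \<subseteq> {..<\<alpha>}) \<and>
        (\<forall>X. stationary {\<alpha>. X \<inter> {..<\<alpha>} = A \<alpha>}))"

text \<open>Graphs are identified with their edge sets; \<open>[UNIV]\<^bsup>2\<^esup>\<close> is the library's set of two-element
  subsets.\<close>

type_synonym graph = "omega1 set set"

definition lower_nbhd :: "graph \<Rightarrow> omega1 \<Rightarrow> omega1 set" where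
  "lower_nbhd G \<alpha> = {\<beta>. \<beta> < \<alpha> \<and> {\<beta>, \<alpha>} \<in> G}"

definition omega_sequence_to :: "omega1 set \<Rightarrow> omega1 \<Rightarrow> bool" where
  "omega_sequence_to A \<alpha> \<longleftrightarrow>
     (\<exists>s :: nat \<Rightarrow> omega1. strict_mono s \<and> range s = A) \<and> isLub UNIV A \<alpha>"

definition hajnal_mate :: "graph \<Rightarrow> bool" where
  "hajnal_mate G \<longleftrightarrow>
     G \<subseteq> [UNIV]\<^bsup>2\<^esup> \<and>
     (\<forall>\<alpha>. finite (lower_nbhd G \<alpha>) \<or> omega_sequence_to (lower_nbhd G \<alpha>) \<alpha>)"

definition triangle_free :: "graph \<Rightarrow> bool" where
  "triangle_free G \<longleftrightarrow>
     \<not> (\<exists>a b c. a \<noteq> b \<and> b \<noteq> c \<and> a \<noteq> c \<and> {a, b} \<in> G \<and> {b, c} \<in> G \<and> {a, c} \<in> G)"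

definition proper_colouring :: "graph \<Rightarrow> (omega1 \<Rightarrow> 'c) \<Rightarrow> bool" where
  "proper_colouring G c \<longleftrightarrow> (\<forall>a b. a \<noteq> b \<and> {a, b} \<in> G \<longrightarrow> c a \<noteq> c b)"

text \<open>The least cardinal of a set of colours.  Colours may be taken in \<open>omega1\<close>, since a colouring
  into any type uses at most \<open>\<aleph>\<^sub>1\<close> colours.  As a well-order relation, the value is determined only
  up to \<open>=o\<close>.\<close>

definition chromatic_number :: "graph \<Rightarrow> omega1 rel" where
  "chromatic_number G =
     (SOME \<kappa>. (\<exists>c :: omega1 \<Rightarrow> omega1. proper_colouring G c \<and> \<kappa> = |range c| ) \<and>
        (\<forall>c :: omega1 \<Rightarrow> omega1. proper_colouring G c \<longrightarrow> \<kappa> \<le>o |range c| ))"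

lemma chromatic_number_attained:
  "\<exists>c :: omega1 \<Rightarrow> omega1. proper_colouring G c \<and> chromatic_number G = |range c|"
  and chromatic_number_le:
  "proper_colouring G (c :: omega1 \<Rightarrow> 'c) \<Longrightarrow> chromatic_number G \<le>o |range c|"
proof -
  let ?R = "{|range c| | c :: omega1 \<Rightarrow> omega1. proper_colouring G c}"
  have "proper_colouring G (id :: omega1 \<Rightarrow> omega1)"
    by (simp add: proper_colouring_def)
  then have "?R \<noteq> {}" by blast
  moreover have "\<forall>r\<in>?R. Card_order r" using card_of_Card_order by blast
  ultimately obtain \<kappa> where "\<kappa> \<in> ?R" "\<forall>r\<in>?R. \<kappa> \<le>o r"
    using exists_minim_Card_order[of ?R] by blast
  then have "\<exists>\<kappa>. (\<exists>c :: omega1 \<Rightarrow> omega1. proper_colouring G c \<and> \<kappa> = |range c| ) \<and>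
        (\<forall>c :: omega1 \<Rightarrow> omega1. proper_colouring G c \<longrightarrow> \<kappa> \<le>o |range c| )"
    by blast
  from someI_ex[OF this]
  have *: "(\<exists>c :: omega1 \<Rightarrow> omega1. proper_colouring G c \<and> chromatic_number G = |range c| ) \<and>
        (\<forall>c :: omega1 \<Rightarrow> omega1. proper_colouring G c \<longrightarrow> chromatic_number G \<le>o |range c| )"
    unfolding chromatic_number_def .
  then show "\<exists>c :: omega1 \<Rightarrow> omega1. proper_colouring G c \<and> chromatic_number G = |range c|"
    by blast
  assume c: "proper_colouring G (c :: omega1 \<Rightarrow> 'c)"
  have inv: "c (inv c (c a)) = c a" for a
    by (simp add: f_inv_into_f)
  have "proper_colouring G (inv c \<circ> c)"
    using c unfolding proper_colouring_def comp_def by (metis inv)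
  then have "chromatic_number G \<le>o |range (inv c \<circ> c)|" using * by blast
  moreover have "|range (inv c \<circ> c)| \<le>o |range c|"
    by (metis card_of_image image_comp)
  ultimately show "chromatic_number G \<le>o |range c|"
    by (rule ordLeq_transitive)
qed

definition uncountable_chromatic_number :: "graph \<Rightarrow> bool" where
  "uncountable_chromatic_number G \<longleftrightarrow> natLeq <o chromatic_number G"

lemma uncountable_chromatic_number_iff:
  "uncountable_chromatic_number G \<longleftrightarrow> \<not> (\<exists>c :: omega1 \<Rightarrow> nat. proper_colouring G c)"
proof -
  obtain c :: "omega1 \<Rightarrow> omega1"
    where c: "proper_colouring G c" "chromatic_number G = |range c|"
    using chromatic_number_attained by blast
  have wo: "Well_order (chromatic_number G)" using c by (simp add: card_of_Well_order)
  have "\<not> uncountable_chromatic_number G \<longleftrightarrow> chromatic_number G \<le>o natLeq"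
    unfolding uncountable_chromatic_number_def
    using not_ordLess_iff_ordLeq[OF wo natLeq_Well_order] by blast
  also have "\<dots> \<longleftrightarrow> (\<exists>c :: omega1 \<Rightarrow> nat. proper_colouring G c)"
  proof
    assume "chromatic_number G \<le>o natLeq"
    then have "countable (range c)" using c by (simp add: countable_card_le_natLeq)
    then have "inj_on (to_nat_on (range c)) (range c)" by (rule inj_on_to_nat_on)
    then have "proper_colouring G (to_nat_on (range c) \<circ> c)"
      using c(1) unfolding proper_colouring_def comp_def inj_on_def by blast
    then show "\<exists>c :: omega1 \<Rightarrow> nat. proper_colouring G c" by blast
  next
    assume "\<exists>c :: omega1 \<Rightarrow> nat. proper_colouring G c"
    then obtain d :: "omega1 \<Rightarrow> nat" where "proper_colouring G d" by blast
    then have "chromatic_number G \<le>o |range d|" by (rule chromatic_number_le)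
    moreover have "|range d| \<le>o natLeq"
      using countable_card_le_natLeq[of "range d"] by simp
    ultimately show "chromatic_number G \<le>o natLeq" by (rule ordLeq_transitive)
  qed
  finally show ?thesis by blast
qed

end

theory Submission
  imports Defs
begin

text \<open>Colour the pairs \<open>\<beta> < \<alpha>\<close> by recursion on \<open>\<alpha>\<close>, keeping every fibre of the colouring of
  \<open>{..<\<alpha>}\<close> independent in its own colour.  At \<open>\<alpha>\<close> the diamond sequence guesses a colour \<open>n\<close> and
  a vertex colouring \<open>f\<close> of \<open>{..<\<alpha>}\<close>.  If some \<open>n\<close>-independent \<open>\<omega>\<close>-sequence converging to \<open>\<alpha>\<close>
  meets every \<open>f\<close>-class unbounded in \<open>\<alpha>\<close>, it becomes the \<open>n\<close>-fibre; all remaining points get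
  pairwise different colours other than \<open>n\<close>.  If \<open>f\<close> coloured the \<open>n\<close>-th graph properly, such a
  sequence could not exist at a correctly guessed large \<open>\<alpha>\<close>, since it would contain a neighbour of
  \<open>\<alpha>\<close> of the same colour.

  It exists at club many \<open>\<alpha>\<close>: call a finite set \<open>F\<close> extendible if each uncountable \<open>f\<close>-class has
  uncountably many points not joined to \<open>F\<close>.  If infinitely many \<open>b\<close> failed to extend \<open>F\<close>
  because of the same class, some point far above them would be joined to infinitely many of them,
  contradicting the Hajnal-Mate property.  So extendible sets can be extended within any
  uncountable class, and at every \<open>\<alpha>\<close> closed under such extensions one builds the sequence.\<close>

section \<open>Bounded sets and closure points in omega_1\<close>

lemma isLub_UNIV_iff:
  fixes a :: "'a::order"
  shows "isLub UNIV S a \<longleftrightarrow> (\<forall>x\<in>S. x \<le> a) \<and> (\<forall>u. (\<forall>x\<in>S. x \<le> u) \<longrightarrow> a \<le> u)"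
  by (auto simp: isLub_def leastP_def isUb_def setle_def setge_def)

lemma countable_atMost_omega1: "countable {..(\<alpha> :: omega1)}"
  using countable_lessThan_omega1[of \<alpha>] by (simp add: ivl_disj_un_singleton(2)[symmetric])

lemma countable_bounded_omega1:
  fixes S :: "omega1 set"
  assumes "countable S"
  obtains d where "S \<subseteq> {..<d}"
proof -
  have "countable (\<Union>x\<in>S. {..x})"
    using assms countable_atMost_omega1 by blast
  then have "(\<Union>x\<in>S. {..x}) \<noteq> UNIV"
    using uncountable_omega1 by metis
  then show thesis
    using that by (fastforce simp: not_le)
qed

text \<open>Unboundedness: iterate omega times a function that dominates \<open>W\<close> on initial
  segments; the supremum of the iterates is closed under \<open>W\<close>. Closedness: a point below
  a supremum is already below some member of the set.\<close>

lemma club_closed_points: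
  fixes W :: "omega1 \<Rightarrow> omega1 set"
  assumes W: "\<And>\<beta>. countable (W \<beta>)"
  shows "club {\<alpha>. d < \<alpha> \<and> (\<forall>\<beta><\<alpha>. W \<beta> \<subseteq> {..<\<alpha>})}" (is "club ?C")
  unfolding club_def
proof (intro conjI allI impI)
  fix a :: omega1
  have "\<exists>y. insert x (\<Union>\<beta>\<in>{..x}. W \<beta>) \<subseteq> {..<y}" for x
    using W countable_atMost_omega1
    by (metis countable_UN countable_insert countable_bounded_omega1)
  then obtain g where g: "\<And>x. insert x (\<Union>\<beta>\<in>{..x}. W \<beta>) \<subseteq> {..<g x}"
    by metis
  define s where "s n = (g ^^ n) (max a d)" for n
  have sSuc: "s (Suc n) = g (s n)" for n
    by (simp add: s_def)
  have s_less: "s n < s (Suc n)" for n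
    using g[of "s n"] by (simp add: sSuc)
  have W_less: "W \<beta> \<subseteq> {..<s (Suc n)}" if "\<beta> \<le> s n" for \<beta> n
    using g[of "s n"] that by (auto simp: sSuc)
  obtain u where u: "range s \<subseteq> {..<u}"
    using countable_bounded_omega1[of "range s"] by auto
  define \<alpha> where "\<alpha> = (LEAST u. \<forall>n. s n < u)"
  have s\<alpha>: "s n < \<alpha>" for n
    unfolding \<alpha>_def using LeastI[of "\<lambda>u. \<forall>n. s n < u" u] u by auto
  have below: "\<exists>n. \<beta> \<le> s n" if "\<beta> < \<alpha>" for \<beta>
    using not_less_Least[OF that[unfolded \<alpha>_def]] by (auto simp: not_less)
  have "max a d < \<alpha>"
    using s\<alpha>[of 0] by (simp add: s_def)
  moreover have "W \<beta> \<subseteq> {..<\<alpha>}" if "\<beta> < \<alpha>" for \<beta>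
    using below[OF that] W_less s\<alpha> by (meson lessThan_subset_iff less_imp_le subset_trans)
  ultimately show "\<exists>\<beta>\<in>?C. a < \<beta>"
    by (intro bexI[of _ \<alpha>]) auto
next
  fix S \<alpha>
  assume "S \<subseteq> ?C \<and> S \<noteq> {} \<and> isLub UNIV S \<alpha>"
  then have S: "S \<subseteq> ?C" "S \<noteq> {}" and ub: "\<And>x. x \<in> S \<Longrightarrow> x \<le> \<alpha>"
    and least: "\<And>u. (\<And>x. x \<in> S \<Longrightarrow> x \<le> u) \<Longrightarrow> \<alpha> \<le> u"
    by (auto simp: isLub_UNIV_iff)
  have "d < \<alpha>"
    using S ub by (blast intro: less_le_trans)
  moreover have "W \<beta> \<subseteq> {..<\<alpha>}" if less: "\<beta> < \<alpha>" for \<beta>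
  proof -
    obtain x where "x \<in> S" "\<beta> < x"
      using least[of \<beta>] less by (meson not_le)
    then have "W \<beta> \<subseteq> {..<x}" "x \<le> \<alpha>"
      using S ub by auto
    then show ?thesis
      by (auto intro: less_le_trans)
  qed
  ultimately show "\<alpha> \<in> ?C" by blast
qed

lemma ex_inj_omega1_times_nat: "\<exists>p :: omega1 \<times> nat \<Rightarrow> omega1. inj p"
proof -
  have inf: "infinite (UNIV :: omega1 set)"
    using uncountable_omega1 countable_finite by blast
  then have "|UNIV :: nat set| \<le>o |UNIV :: omega1 set|"
    by (simp add: infinite_iff_card_of_nat)
  then have "|(UNIV :: omega1 set) \<times> (UNIV :: nat set)| \<le>o |UNIV :: omega1 set|"
    using card_of_Times_infinite[OF inf] ordIso_imp_ordLeq by blast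
  then show ?thesis
    by (simp add: card_of_ordLeq[symmetric])
qed

section \<open>Admissible rows and the recursive edge colouring\<close>

text \<open>Throughout, the colour of a pair \<open>\<beta> < \<alpha>\<close> is \<open>c \<alpha> \<beta>\<close>; the values \<open>c \<alpha> \<beta>\<close> with \<open>\<alpha> \<le> \<beta>\<close> are
  irrelevant.\<close>

definition fibre :: "omega1 \<Rightarrow> (omega1 \<Rightarrow> nat) \<Rightarrow> nat \<Rightarrow> omega1 set" where
  "fibre \<alpha> h m = {\<beta>. \<beta> < \<alpha> \<and> h \<beta> = m}"

definition independent_in :: "(omega1 \<Rightarrow> omega1 \<Rightarrow> nat) \<Rightarrow> nat \<Rightarrow> omega1 set \<Rightarrow> bool" where
  "independent_in c n S \<longleftrightarrow> (\<forall>\<beta>\<in>S. \<forall>\<gamma>\<in>S. \<beta> < \<gamma> \<longrightarrow> c \<gamma> \<beta> \<noteq> n)"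

text \<open>\<open>S\<close> is a candidate for the lower neighbourhood of \<alpha> in colour
  \<open>n\<close>. Independence excludes triangles with top vertex \<alpha>; the last clause yields
  an edge with equal vertex colours at \<alpha> as soon as the class of \<alpha> is unbounded below
  \<alpha>.\<close>

definition transversal_at ::
  "(omega1 \<Rightarrow> omega1 \<Rightarrow> nat) \<Rightarrow> nat \<Rightarrow> (omega1 \<Rightarrow> nat) \<Rightarrow> omega1 \<Rightarrow> omega1 set \<Rightarrow> bool" where
  "transversal_at c n f \<alpha> S \<longleftrightarrow>
     S \<subseteq> {..<\<alpha>} \<and> omega_sequence_to S \<alpha> \<and> independent_in c n S \<and>
     (\<forall>k. (\<forall>\<delta><\<alpha>. \<exists>\<beta>. \<delta> < \<beta> \<and> \<beta> < \<alpha> \<and> f \<beta> = k) \<longrightarrow> (\<exists>\<beta>\<in>S. f \<beta> = k))"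

text \<open>Diamond guesses subsets of omega_1, so \<open>n\<close> and the values of
  \<open>f\<close> on \<open>Y\<close> are packed into one set. Every element carries
  \<open>n\<close>, hence a single point of \<open>Y\<close> recovers it.\<close>

definition encode :: "(omega1 \<times> nat \<Rightarrow> omega1) \<Rightarrow> nat \<Rightarrow> (omega1 \<Rightarrow> nat) \<Rightarrow> omega1 set \<Rightarrow> omega1 set" where
  "encode p n f Y = (\<lambda>\<beta>. p (\<beta>, prod_encode (n, f \<beta>))) ` Y"

text \<open>The demands on the row \<open>h\<close> consult \<open>c\<close> only below \<alpha>, so
  rows can be chosen by recursion. The first group gives the Hajnal-Mate property and
  triangle-freeness, the last clause the uncountable chromatic number.\<close>

definition admissible ::
  "(omega1 \<times> nat \<Rightarrow> omega1) \<Rightarrow> (omega1 \<Rightarrow> omega1 set) \<Rightarrow> (omega1 \<Rightarrow> omega1 \<Rightarrow> nat) \<Rightarrow>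
     omega1 \<Rightarrow> (omega1 \<Rightarrow> nat) \<Rightarrow> bool" where
  "admissible p A c \<alpha> h \<longleftrightarrow>
     (\<forall>m. (finite (fibre \<alpha> h m) \<or> omega_sequence_to (fibre \<alpha> h m) \<alpha>) \<and>
          independent_in c m (fibre \<alpha> h m)) \<and>
     (\<forall>n f. A \<alpha> = encode p n f {..<\<alpha>} \<and> (\<exists>S. transversal_at c n f \<alpha> S) \<longrightarrow>
            transversal_at c n f \<alpha> (fibre \<alpha> h n))"

lemma omega_sequence_to_nonempty: "omega_sequence_to S \<alpha> \<Longrightarrow> S \<noteq> {}"
  by (auto simp: omega_sequence_to_def)

text \<open>An increasing sequence that has passed \<delta> never returns below it. In a Hajnal-Mate
  graph a vertex thus has only finitely many neighbours below any smaller bound.\<close>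

lemma finite_omega_sequence_below:
  assumes "omega_sequence_to S \<gamma>" "\<delta> < \<gamma>"
  shows "finite {\<beta>\<in>S. \<beta> \<le> \<delta>}"
proof -
  obtain s :: "nat \<Rightarrow> omega1" where s: "strict_mono s" "range s = S" and lub: "isLub UNIV S \<gamma>"
    using assms(1) by (auto simp: omega_sequence_to_def)
  obtain n where n: "\<delta> < s n"
    using lub assms(2) s(2) by (metis isLub_UNIV_iff not_le rangeE)
  have "{\<beta>\<in>S. \<beta> \<le> \<delta>} \<subseteq> s ` {..<n}"
    using s n by (auto simp: image_iff) (metis le_less_trans lessThan_iff strict_mono_less)
  then show ?thesis
    using finite_surj by blast
qed

lemma encode_eqD:
  assumes "inj p" "encode p n f Y = encode p n' f' Y" "\<beta> \<in> Y"
  shows "n = n'" "f \<beta> = f' \<beta>"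
proof -
  have "p (\<beta>, prod_encode (n, f \<beta>)) \<in> encode p n' f' Y"
    using assms(2,3) unfolding encode_def by blast
  then obtain \<gamma> where "p (\<beta>, prod_encode (n, f \<beta>)) = p (\<gamma>, prod_encode (n', f' \<gamma>))"
    by (auto simp: encode_def)
  then have "(\<beta>, prod_encode (n, f \<beta>)) = (\<gamma>, prod_encode (n', f' \<gamma>))"
    using \<open>inj p\<close> by (auto dest: injD)
  then show "n = n'" "f \<beta> = f' \<beta>"
    by (metis Pair_inject prod_encode_eq)+
qed

lemma transversal_at_cong:
  assumes "\<And>\<beta>. \<beta> < \<alpha> \<Longrightarrow> c \<beta> = c' \<beta>" "\<And>\<beta>. \<beta> < \<alpha> \<Longrightarrow> f \<beta> = f' \<beta>"
  shows "transversal_at c n f \<alpha> S \<longleftrightarrow> transversal_at c' n f' \<alpha> S"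
proof -
  have "(\<exists>\<beta>\<in>S. f \<beta> = k) \<longleftrightarrow> (\<exists>\<beta>\<in>S. f' \<beta> = k)" if "S \<subseteq> {..<\<alpha>}" for k
    using that assms(2) by (metis lessThan_iff subsetD)
  moreover have "independent_in c n S \<longleftrightarrow> independent_in c' n S" if "S \<subseteq> {..<\<alpha>}"
    using that assms(1) by (auto simp: independent_in_def subset_iff)
  moreover have "\<delta> < \<beta> \<and> \<beta> < \<alpha> \<and> f \<beta> = k \<longleftrightarrow> \<delta> < \<beta> \<and> \<beta> < \<alpha> \<and> f' \<beta> = k" for \<delta> \<beta> k
    using assms(2) by auto
  ultimately show ?thesis
    unfolding transversal_at_def by (simp cong: conj_cong)
qed

text \<open>A guess that admits a transversal fixes \<open>n\<close> and the values of
  \<open>f\<close> below \<alpha>, so one \<open>S\<close> serves all decodings. It becomes the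
  \<open>n\<close>-fibre; the other fibres have at most one point.\<close>

lemma ex_admissible:
  assumes p: "inj p"
  shows "\<exists>h. admissible p A c \<alpha> h"
proof -
  obtain n S where S: "S = {} \<or> omega_sequence_to S \<alpha>" "independent_in c n S" "S \<subseteq> {..<\<alpha>}"
    and guess: "\<And>n' f T. A \<alpha> = encode p n' f {..<\<alpha>} \<Longrightarrow> transversal_at c n' f \<alpha> T \<Longrightarrow>
      n' = n \<and> transversal_at c n f \<alpha> S"
  proof (cases "\<exists>n f T. A \<alpha> = encode p n f {..<\<alpha>} \<and> transversal_at c n f \<alpha> T")
    case True
    then obtain n f T where A: "A \<alpha> = encode p n f {..<\<alpha>}" and T: "transversal_at c n f \<alpha> T"
      by blast
    then have T': "omega_sequence_to T \<alpha>" "independent_in c n T" "T \<subseteq> {..<\<alpha>}"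
      by (auto simp: transversal_at_def)
    \<comment> \<open>A point below \<alpha> is needed: an empty encoding would not determine
      \<open>n\<close>.\<close>
    then obtain \<beta> where \<beta>: "\<beta> < \<alpha>"
      using omega_sequence_to_nonempty by blast
    have "n' = n \<and> transversal_at c n f' \<alpha> T" if "A \<alpha> = encode p n' f' {..<\<alpha>}" for n' f'
    proof -
      have eq: "encode p n f {..<\<alpha>} = encode p n' f' {..<\<alpha>}"
        using A that by simp
      have "n = n'" "\<And>\<gamma>. \<gamma> < \<alpha> \<Longrightarrow> f \<gamma> = f' \<gamma>"
        using encode_eqD[OF p eq] \<beta> by auto
      then show ?thesis
        using T transversal_at_cong[of \<alpha> c c f f'] by auto
    qed
    then show thesis
      using that[of T n] T' by blast
  next
    case False
    then show thesis
      using that[of "{}" 0] by (auto simp: independent_in_def)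
  qed
  define g where "g = to_nat_on {..<\<alpha>}"
  have g: "inj_on g {..<\<alpha>}"
    unfolding g_def by (rule inj_on_to_nat_on[OF countable_lessThan_omega1])
  \<comment> \<open>Skipping the value \<open>n\<close> keeps the colours outside \<open>S\<close>
    injective and off the \<open>n\<close>-fibre.\<close>
  define h where "h \<beta> = (if \<beta> \<in> S then n else if g \<beta> < n then g \<beta> else Suc (g \<beta>))" for \<beta>
  have n: "fibre \<alpha> h n = S"
    using S(3) by (auto simp: fibre_def h_def split: if_splits)
  have m: "\<exists>x. fibre \<alpha> h m \<subseteq> {x}" if "m \<noteq> n" for m
  proof -
    have "\<beta> = \<gamma>" if "\<beta> \<in> fibre \<alpha> h m" "\<gamma> \<in> fibre \<alpha> h m" for \<beta> \<gamma>
    proof -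
      have "\<beta> < \<alpha>" "\<gamma> < \<alpha>" "g \<beta> = g \<gamma>"
        using that \<open>m \<noteq> n\<close> by (auto simp: fibre_def h_def split: if_splits)
      then show ?thesis
        using g by (auto dest: inj_onD)
    qed
    then show ?thesis by blast
  qed
  have "finite (fibre \<alpha> h m) \<or> omega_sequence_to (fibre \<alpha> h m) \<alpha>" for m
    using S(1) n m[of m] by (cases "m = n") (auto intro: finite_subset)
  moreover have "independent_in c m (fibre \<alpha> h m)" for m
  proof (cases "m = n")
    case False
    then obtain x where "fibre \<alpha> h m \<subseteq> {x}" using m by blast
    then show ?thesis
      unfolding independent_in_def by (metis less_irrefl singletonD subsetD)
  qed (use n S(2) in auto)
  ultimately have "admissible p A c \<alpha> h"
    unfolding admissible_def using guess n by blast
  then show ?thesis by blast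
qed

lemma admissible_cong:
  assumes c: "\<And>\<beta>. \<beta> < \<alpha> \<Longrightarrow> c \<beta> = c' \<beta>"
  shows "admissible p A c \<alpha> h = admissible p A c' \<alpha> h"
proof -
  have "independent_in c m (fibre \<alpha> h m) = independent_in c' m (fibre \<alpha> h m)" for m
    using c by (auto simp: independent_in_def fibre_def)
  moreover have "transversal_at c n f \<alpha> = transversal_at c' n f \<alpha>" for n f
    using c by (intro ext transversal_at_cong) auto
  ultimately show ?thesis
    unfolding admissible_def by simp
qed

lemma ex_admissible_colouring:
  assumes "inj p"
  shows "\<exists>c. \<forall>\<alpha>. admissible p A c \<alpha> (c \<alpha>)"
proof (rule dependent_wf_choice[where P = "admissible p A"])
  show "wf {(x, y :: omega1). x < y}" by (rule wf)
  show "admissible p A c \<alpha> h = admissible p A c' \<alpha> h"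
    if "\<And>\<beta>. (\<beta>, \<alpha>) \<in> {(x, y). x < y} \<Longrightarrow> c \<beta> = c' \<beta>" for c c' \<alpha> h
    using that by (intro admissible_cong) auto
  show "\<exists>h. admissible p A c \<alpha> h" for c \<alpha>
    using assms by (rule ex_admissible)
qed

section \<open>Extendible finite sets and the construction of transversals\<close>

text \<open>The guard \<open>\<beta> < \<gamma>\<close> matters for only countably many \<gamma>,
  since \<open>F\<close> is finite and initial segments are countable.\<close>

definition extendible ::
  "(omega1 \<Rightarrow> omega1 \<Rightarrow> nat) \<Rightarrow> nat \<Rightarrow> (omega1 \<Rightarrow> nat) \<Rightarrow> omega1 set \<Rightarrow> bool" where
  "extendible c n f F \<longleftrightarrow> finite F \<and> independent_in c n F \<and>
     (\<forall>k. uncountable (f -` {k}) \<longrightarrow>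
        uncountable {\<gamma>. f \<gamma> = k \<and> (\<forall>\<beta>\<in>F. \<beta> < \<gamma> \<longrightarrow> c \<gamma> \<beta> \<noteq> n)})"

text \<open>Adding any member of \<open>B k\<close> above \<delta> keeps the set independent. Each
  uncountable class rules out only finitely many points, and there are countably many classes, so
  the uncountable set \<open>B k\<close> still offers a good point.\<close>

lemma extendible_insert:
  assumes fin: "\<And>\<gamma> \<delta>. \<delta> < \<gamma> \<Longrightarrow> finite {\<beta>. \<beta> \<le> \<delta> \<and> c \<gamma> \<beta> = n}"
    and F: "extendible c n f F" and k: "uncountable (f -` {k})" and \<delta>: "F \<subseteq> {..\<delta>}"
  obtains b where "\<delta> < b" "f b = k" "extendible c n f (insert b F)"
proof -
  define B where "B j = {\<gamma>. f \<gamma> = j \<and> (\<forall>\<beta>\<in>F. \<beta> < \<gamma> \<longrightarrow> c \<gamma> \<beta> \<noteq> n)}" for j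
  define N where "N b = {\<gamma>. b < \<gamma> \<and> c \<gamma> b = n}" for b
  have B: "uncountable (B j)" if "uncountable (f -` {j})" for j
    using F that by (auto simp: extendible_def B_def)
  define bad where "bad j = {b. countable (B j - N b)}" for j
  have finite_bad: "finite (bad j)" if j: "uncountable (f -` {j})" for j
  proof (rule ccontr)
    assume "infinite (bad j)"
    \<comment> \<open>A countable infinite part suffices, and it is bounded in omega_1.\<close>
    then obtain D where D: "countable D" "infinite D" "D \<subseteq> bad j"
      using infinite_countable_subset' by blast
    obtain d where d: "D \<subseteq> {..<d}"
      using countable_bounded_omega1[OF D(1)] by blast
    have "countable (\<Union>b\<in>D. B j - N b)"
      using D by (intro countable_UN) (auto simp: bad_def)
    then have "countable ((\<Union>b\<in>D. B j - N b) \<union> {..d})"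
      using countable_atMost_omega1 by blast
    \<comment> \<open>A point of \<open>B j\<close> above \<open>d\<close> that escapes all these
      countable differences is joined to every member of \<open>D\<close>.\<close>
    then have "\<not> B j \<subseteq> (\<Union>b\<in>D. B j - N b) \<union> {..d}"
      using B[OF j] countable_subset by blast
    then obtain \<gamma> where \<gamma>: "d < \<gamma>" "\<forall>b\<in>D. \<gamma> \<in> N b"
      by (auto simp: not_le)
    then have "D \<subseteq> {\<beta>. \<beta> \<le> d \<and> c \<gamma> \<beta> = n}"
      using d by (auto simp: N_def intro: less_imp_le)
    then show False
      using fin[OF \<gamma>(1)] D(2) finite_subset by blast
  qed
  have "countable ((\<Union>j\<in>{j. uncountable (f -` {j})}. bad j) \<union> {..\<delta>})"
    using finite_bad countable_finite countable_atMost_omega1 by auto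
  then have "\<not> B k \<subseteq> (\<Union>j\<in>{j. uncountable (f -` {j})}. bad j) \<union> {..\<delta>}"
    using B[OF k] countable_subset by blast
  then obtain b where "b \<in> B k" "b \<notin> (\<Union>j\<in>{j. uncountable (f -` {j})}. bad j) \<union> {..\<delta>}"
    by blast
  then have b: "b \<in> B k" "\<delta> < b" "\<And>j. uncountable (f -` {j}) \<Longrightarrow> b \<notin> bad j"
    by (auto simp: not_le)
  have "independent_in c n (insert b F)"
    unfolding independent_in_def
  proof (intro ballI impI)
    fix \<beta> \<gamma> assume "\<beta> \<in> insert b F" "\<gamma> \<in> insert b F" "\<beta> < \<gamma>"
    moreover from this have "\<beta> \<in> F"
      using b(2) \<delta> by force
    ultimately show "c \<gamma> \<beta> \<noteq> n"
      using F b(1) by (auto simp: independent_in_def extendible_def B_def)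
  qed
  moreover have "uncountable {\<gamma>. f \<gamma> = j \<and> (\<forall>\<beta>\<in>insert b F. \<beta> < \<gamma> \<longrightarrow> c \<gamma> \<beta> \<noteq> n)}"
    if "uncountable (f -` {j})" for j
  proof -
    have "uncountable (B j - N b)"
      using b(3)[OF that] by (simp add: bad_def)
    moreover have "B j - N b = {\<gamma>. f \<gamma> = j \<and> (\<forall>\<beta>\<in>insert b F. \<beta> < \<gamma> \<longrightarrow> c \<gamma> \<beta> \<noteq> n)}"
      by (auto simp: B_def N_def)
    ultimately show ?thesis by simp
  qed
  ultimately have "extendible c n f (insert b F)"
    using F by (auto simp: extendible_def)
  then show thesis
    using that b by (auto simp: B_def)
qed

lemma extendible_empty: "extendible c n f {}"
  by (auto simp: extendible_def independent_in_def vimage_def)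

text \<open>Term \<open>i\<close> of the sequence is placed beyond the point \<open>e i\<close> and
  in the class \<open>k i\<close>, where \<open>e\<close> enumerates the points below \<alpha> and
  \<open>k\<close> the uncountable classes. Keeping each finite stage extendible makes the whole
  sequence independent.\<close>

lemma ex_transversal_at:
  fixes \<alpha> d :: omega1
  assumes "d < \<alpha>"
    and small: "\<And>k. countable (f -` {k}) \<Longrightarrow> f -` {k} \<subseteq> {..<d}"
    and w: "\<And>\<delta> F k. \<delta> < \<alpha> \<Longrightarrow> F \<subseteq> {..\<delta>} \<Longrightarrow> extendible c n f F \<Longrightarrow> uncountable (f -` {k}) \<Longrightarrow>
      \<exists>b. \<delta> < b \<and> b < \<alpha> \<and> f b = k \<and> extendible c n f (insert b F)"
  shows "\<exists>S. transversal_at c n f \<alpha> S"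
proof -
  define K where "K = {k. uncountable (f -` {k})}"
  \<comment> \<open>The class of \<open>d\<close> contains \<open>d\<close>, so it is not confined
    below \<open>d\<close> and cannot be countable.\<close>
  have "K \<noteq> {}"
  proof
    assume "K = {}"
    then have "f -` {f d} \<subseteq> {..<d}"
      using small by (auto simp: K_def)
    then show False by auto
  qed
  define k where "k = from_nat_into K"
  have k: "uncountable (f -` {k i})" for i
    using from_nat_into[OF \<open>K \<noteq> {}\<close>, of i] by (simp add: K_def k_def)
  define e where "e = from_nat_into {..<\<alpha>}"
  have ne: "{..<\<alpha>} \<noteq> {}" using \<open>d < \<alpha>\<close> by auto
  have range_e: "range e = {..<\<alpha>}"
    unfolding e_def using range_from_nat_into[OF ne countable_lessThan_omega1] .
  \<comment> \<open>The clause for stage \<open>0\<close> forces an empty start, so that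
    \<open>F i\<close> consists exactly of the first \<open>i\<close> chosen points.\<close>
  define P where "P i F \<longleftrightarrow> F \<subseteq> {..<\<alpha>} \<and> extendible c n f F \<and> (i = (0::nat) \<longrightarrow> F = {})" for i F
  define Q where "Q i F b F' \<longleftrightarrow> F' = insert b F \<and> f b = k i \<and> e i < b \<and> (\<forall>x\<in>F. x < b)" for i F b F'
  have "\<exists>F. \<forall>i. P i (F i) \<and> (\<exists>b. Q i (F i) b (F (Suc i)))"
  proof (rule dependent_nat_choice)
    show "\<exists>F. P 0 F"
      by (auto simp: P_def extendible_empty)
    fix F i
    assume F: "P i F"
    let ?\<delta> = "Max (insert (e i) F)"
    have "finite F" using F by (simp add: P_def extendible_def)
    then have le: "\<forall>x\<in>insert (e i) F. x \<le> ?\<delta>" by auto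
    have "e i < \<alpha>" using range_e by auto
    then have "?\<delta> < \<alpha>"
      using \<open>finite F\<close> F by (auto simp: P_def)
    moreover have "F \<subseteq> {..?\<delta>}" using le by auto
    ultimately obtain b where b: "?\<delta> < b" "b < \<alpha>" "f b = k i" "extendible c n f (insert b F)"
      using w[of ?\<delta> F "k i"] F k by (auto simp only: P_def)
    have "\<forall>x\<in>insert (e i) F. x < b"
      using le b(1) le_less_trans by blast
    then have "P (Suc i) (insert b F) \<and> Q i F b (insert b F)"
      using b F by (auto simp: P_def Q_def)
    then show "\<exists>F'. P (Suc i) F' \<and> (\<exists>b. Q i F b F')" by blast
  qed
  then obtain F b where P: "\<And>i. P i (F i)" and Q: "\<And>i. Q i (F i) (b i) (F (Suc i))"
    by metis
  have F: "F i = b ` {..<i}" for i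
  proof (induction i)
    case 0
    then show ?case using P[of 0] by (simp add: P_def)
  next
    case (Suc i)
    then show ?case using Q[of i] by (simp add: Q_def lessThan_Suc)
  qed
  have mono: "strict_mono b"
    unfolding strict_mono_def using Q F by (auto simp: Q_def)
  have b_less: "b i < \<alpha>" for i
    using P[of "Suc i"] F[of "Suc i"] by (auto simp: P_def)
  have cofinal: "\<exists>i. \<delta> < b i" if "\<delta> < \<alpha>" for \<delta>
  proof -
    have "\<delta> \<in> range e" using that range_e by simp
    then obtain i where "\<delta> = e i" by blast
    then show ?thesis using Q[of i] by (auto simp: Q_def)
  qed
  have "isLub UNIV (range b) \<alpha>"
    unfolding isLub_UNIV_iff
  proof (intro conjI allI impI ballI)
    show "x \<le> \<alpha>" if "x \<in> range b" for x
      using that b_less by (auto intro: less_imp_le)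
    show "\<alpha> \<le> u" if "\<forall>x\<in>range b. x \<le> u" for u
      using that cofinal[of u] by (meson not_le rangeI)
  qed
  then have "omega_sequence_to (range b) \<alpha>"
    using mono by (auto simp: omega_sequence_to_def)
  moreover have "independent_in c n (range b)"
    unfolding independent_in_def
  proof (intro ballI impI)
    fix \<beta> \<gamma> assume "\<beta> \<in> range b" "\<gamma> \<in> range b" "\<beta> < \<gamma>"
    then obtain i j where ij: "\<beta> = b i" "\<gamma> = b j" by blast
    have "independent_in c n (F (Suc (max i j)))"
      using P by (auto simp: P_def extendible_def)
    moreover have "\<beta> \<in> F (Suc (max i j))" "\<gamma> \<in> F (Suc (max i j))"
      using ij by (auto simp: F)
    ultimately show "c \<gamma> \<beta> \<noteq> n"
      using \<open>\<beta> < \<gamma>\<close> by (auto simp: independent_in_def)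
  qed
  moreover have "\<exists>\<beta>\<in>range b. f \<beta> = l"
    if l: "\<forall>\<delta><\<alpha>. \<exists>\<beta>. \<delta> < \<beta> \<and> \<beta> < \<alpha> \<and> f \<beta> = l" for l
  proof -
    \<comment> \<open>A class with a point beyond \<open>d\<close> is uncountable, hence is among
      those visited.\<close>
    obtain \<beta> where "d < \<beta>" "f \<beta> = l" using l \<open>d < \<alpha>\<close> by blast
    then have "\<beta> \<in> f -` {l} - {..<d}" by simp
    then have "l \<in> K"
      using small[of l] by (auto simp only: K_def)
    then obtain i where "k i = l"
      unfolding k_def using from_nat_into_surj[of K l] by auto
    then show ?thesis using Q[of i] by (auto simp: Q_def)
  qed
  ultimately have "transversal_at c n f \<alpha> (range b)"
    using b_less by (auto simp: transversal_at_def)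
  then show ?thesis by blast
qed

section \<open>Diamond defeats every countable vertex colouring\<close>

lemma not_proper_if_admissible:
  fixes f :: "omega1 \<Rightarrow> nat"
  assumes p: "inj p" and A: "\<And>X. stationary {\<alpha>. X \<inter> {..<\<alpha>} = A \<alpha>}"
    and c: "\<And>\<alpha>. admissible p A c \<alpha> (c \<alpha>)"
  shows "\<exists>\<alpha> \<beta>. \<beta> < \<alpha> \<and> c \<alpha> \<beta> = n \<and> f \<alpha> = f \<beta>"
proof -
  have fin: "finite {\<beta>. \<beta> \<le> \<delta> \<and> c \<gamma> \<beta> = n}" if "\<delta> < \<gamma>" for \<gamma> \<delta>
  proof -
    have "finite (fibre \<gamma> (c \<gamma>) n) \<or> omega_sequence_to (fibre \<gamma> (c \<gamma>) n) \<gamma>"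
      using c by (auto simp: admissible_def)
    then have "finite {\<beta> \<in> fibre \<gamma> (c \<gamma>) n. \<beta> \<le> \<delta>}"
      using finite_omega_sequence_below that by auto
    moreover have "{\<beta> \<in> fibre \<gamma> (c \<gamma>) n. \<beta> \<le> \<delta>} = {\<beta>. \<beta> \<le> \<delta> \<and> c \<gamma> \<beta> = n}"
      using that by (auto simp: fibre_def)
    ultimately show ?thesis by simp
  qed
  \<comment> \<open>There are only countably many colours, so one \<open>d\<close> bounds all
    countable classes together.\<close>
  have "countable (\<Union>k\<in>{k. countable (f -` {k})}. f -` {k})"
    by auto
  then obtain d where d: "(\<Union>k\<in>{k. countable (f -` {k})}. f -` {k}) \<subseteq> {..<d}"
    using countable_bounded_omega1 by blast
  define w where
    "w \<delta> F k = (SOME b. \<delta> < b \<and> f b = k \<and> extendible c n f (insert b F))" for \<delta> F k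
  have w: "\<delta> < w \<delta> F k \<and> f (w \<delta> F k) = k \<and> extendible c n f (insert (w \<delta> F k) F)"
    if F: "F \<subseteq> {..\<delta>}" "extendible c n f F" and k: "uncountable (f -` {k})" for \<delta> F k
  proof -
    obtain b where "\<delta> < b" "f b = k" "extendible c n f (insert b F)"
      by (rule extendible_insert[OF fin F(2) k F(1)])
    then have "\<exists>b. \<delta> < b \<and> f b = k \<and> extendible c n f (insert b F)" by blast
    from someI_ex[OF this] show ?thesis
      unfolding w_def .
  qed
  \<comment> \<open>Closure under the first part keeps the chosen extensions below \<alpha>. The
    other two parts make \<open>p (\<beta>, m) < \<alpha>\<close> equivalent to
    \<open>\<beta> < \<alpha>\<close>, so cutting the code of \<open>f\<close> at \<alpha> gives the
    code of its restriction.\<close>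
  define W where "W \<delta> = (\<Union>k. (\<lambda>F. w \<delta> F k) ` {F. finite F \<and> F \<subseteq> {..\<delta>}}) \<union>
      range (\<lambda>m. p (\<delta>, m)) \<union> {fst (inv p \<delta>)}" for \<delta>
  have "countable (W \<delta>)" for \<delta>
    unfolding W_def using countable_Collect_finite_subset[OF countable_atMost_omega1] by auto
  then have "club {\<alpha>. d < \<alpha> \<and> (\<forall>\<beta><\<alpha>. W \<beta> \<subseteq> {..<\<alpha>})}"
    by (rule club_closed_points)
  then have "{\<alpha>. encode p n f UNIV \<inter> {..<\<alpha>} = A \<alpha>} \<inter> {\<alpha>. d < \<alpha> \<and> (\<forall>\<beta><\<alpha>. W \<beta> \<subseteq> {..<\<alpha>})} \<noteq> {}"
    using A[of "encode p n f UNIV"] unfolding stationary_def by blast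
  then obtain \<alpha> where guess: "encode p n f UNIV \<inter> {..<\<alpha>} = A \<alpha>" and "d < \<alpha>"
    and W: "\<And>\<beta>. \<beta> < \<alpha> \<Longrightarrow> W \<beta> \<subseteq> {..<\<alpha>}"
    by blast
  have p_less: "p (\<beta>, m) < \<alpha> \<longleftrightarrow> \<beta> < \<alpha>" for \<beta> m
  proof
    assume "p (\<beta>, m) < \<alpha>"
    then have "fst (inv p (p (\<beta>, m))) < \<alpha>"
      using W[of "p (\<beta>, m)"] by (auto simp: W_def)
    then show "\<beta> < \<alpha>" using p by simp
  next
    assume "\<beta> < \<alpha>"
    then show "p (\<beta>, m) < \<alpha>" using W[of \<beta>] by (auto simp: W_def)
  qed
  have A\<alpha>: "A \<alpha> = encode p n f {..<\<alpha>}"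
    unfolding guess[symmetric] encode_def using p_less by auto
  have w_less: "w \<delta> F k < \<alpha>" if "\<delta> < \<alpha>" "F \<subseteq> {..\<delta>}" "extendible c n f F" for \<delta> F k
    using W[OF that(1)] that by (auto simp: W_def extendible_def image_subset_iff)
  have unc: "uncountable (f -` {f \<alpha>})"
  proof
    assume "countable (f -` {f \<alpha>})"
    then have "\<alpha> \<in> (\<Union>k\<in>{k. countable (f -` {k})}. f -` {k})" by blast
    then show False
      using d \<open>d < \<alpha>\<close> by (meson lessThan_iff not_less_iff_gr_or_eq subsetD)
  qed
  have "\<exists>S. transversal_at c n f \<alpha> S"
  proof (rule ex_transversal_at[OF \<open>d < \<alpha>\<close>])
    show "f -` {k} \<subseteq> {..<d}" if "countable (f -` {k})" for k
      using d that by blast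
    show "\<exists>b. \<delta> < b \<and> b < \<alpha> \<and> f b = k \<and> extendible c n f (insert b F)"
      if "\<delta> < \<alpha>" "F \<subseteq> {..\<delta>}" "extendible c n f F" "uncountable (f -` {k})" for \<delta> F k
      using w[OF that(2-4)] w_less[OF that(1-3)] by blast
  qed
  then have "transversal_at c n f \<alpha> (fibre \<alpha> (c \<alpha>) n)"
    using c[of \<alpha>] A\<alpha> unfolding admissible_def by blast
  \<comment> \<open>Extending the empty set above each \<delta> shows that the class of \<alpha>
    itself is unbounded below \<alpha>, so the fibre must meet it.\<close>
  moreover have "\<exists>\<beta>. \<delta> < \<beta> \<and> \<beta> < \<alpha> \<and> f \<beta> = f \<alpha>" if "\<delta> < \<alpha>" for \<delta>
    using w[OF _ extendible_empty unc, of \<delta>] w_less[OF that _ extendible_empty, of "f \<alpha>"] by blast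
  ultimately obtain \<beta> where "\<beta> \<in> fibre \<alpha> (c \<alpha>) n" "f \<beta> = f \<alpha>"
    unfolding transversal_at_def by blast
  then have "\<beta> < \<alpha> \<and> c \<alpha> \<beta> = n \<and> f \<alpha> = f \<beta>"
    by (simp add: fibre_def)
  then show ?thesis by blast
qed

section \<open>The graphs of the colours and the final partition\<close>

definition colour_graph :: "(omega1 \<Rightarrow> omega1 \<Rightarrow> nat) \<Rightarrow> nat \<Rightarrow> graph" where
  "colour_graph c n = {{\<beta>, \<alpha>} | \<beta> \<alpha>. \<beta> < \<alpha> \<and> c \<alpha> \<beta> = n}"

lemma doubleton_in_colour_graph_iff:
  assumes "\<beta> < \<alpha>"
  shows "{\<beta>, \<alpha>} \<in> colour_graph c n \<longleftrightarrow> c \<alpha> \<beta> = n"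
  using assms by (auto simp: colour_graph_def doubleton_eq_iff)

lemma lower_nbhd_colour_graph: "lower_nbhd (colour_graph c n) \<alpha> = fibre \<alpha> (c \<alpha>) n"
  by (auto simp: lower_nbhd_def fibre_def doubleton_in_colour_graph_iff)

text \<open>In a triangle, the two smaller vertices lie in the fibre of the largest one and would be
  joined inside it.\<close>

lemma triangle_free_colour_graph:
  assumes ind: "\<And>\<alpha>. independent_in c n (fibre \<alpha> (c \<alpha>) n)"
  shows "triangle_free (colour_graph c n)"
proof -
  have *: "\<not> ({x, y} \<in> colour_graph c n \<and> {y, z} \<in> colour_graph c n \<and> {x, z} \<in> colour_graph c n)"
    if "x < y" "y < z" for x y z
  proof -
    have "x < z" using that by simp
    then show ?thesis
      using that ind[of z]
      by (auto simp: doubleton_in_colour_graph_iff independent_in_def fibre_def)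
  qed
  show ?thesis
    unfolding triangle_free_def
  proof clarify
    fix x y z :: omega1
    assume "x \<noteq> y" "y \<noteq> z" "x \<noteq> z"
      and "{x, y} \<in> colour_graph c n" "{y, z} \<in> colour_graph c n" "{x, z} \<in> colour_graph c n"
    then show False
      using *[of x y z] *[of x z y] *[of y x z] *[of y z x] *[of z x y] *[of z y x]
      by (auto simp: insert_commute neq_iff)
  qed
qed

theorem theorem4p5:
  assumes "diamond"
  shows "\<exists>G :: nat \<Rightarrow> graph.
           (\<Union>n. G n) = [UNIV]\<^bsup>2\<^esup> \<and> disjoint_family G \<and>
           (\<forall>n. triangle_free (G n) \<and> hajnal_mate (G n) \<and> uncountable_chromatic_number (G n))"
proof -
  obtain A where A: "\<And>X. stationary {\<alpha>. X \<inter> {..<\<alpha>} = A \<alpha>}"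
    using assms by (auto simp: diamond_def)
  obtain p :: "omega1 \<times> nat \<Rightarrow> omega1" where p: "inj p"
    using ex_inj_omega1_times_nat by blast
  obtain c where c: "\<And>\<alpha>. admissible p A c \<alpha> (c \<alpha>)"
    using ex_admissible_colouring[OF p] by blast
  let ?G = "colour_graph c"
  have union: "(\<Union>n. ?G n) = [UNIV]\<^bsup>2\<^esup>"
  proof (intro equalityI subsetI)
    fix E assume "E \<in> (\<Union>n. ?G n)"
    then show "E \<in> [UNIV]\<^bsup>2\<^esup>"
      by (auto simp: colour_graph_def nsets_def)
  next
    fix E :: "omega1 set" assume "E \<in> [UNIV]\<^bsup>2\<^esup>"
    then obtain x y where "E = {x, y}" "x < y"
      by (auto simp: nsets_def card_2_iff) (metis insert_commute neq_iff)
    then show "E \<in> (\<Union>n. ?G n)"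
      by (auto simp: colour_graph_def)
  qed
  moreover have "disjoint_family ?G"
    unfolding disjoint_family_on_def colour_graph_def by (auto simp: doubleton_eq_iff)
  moreover have "triangle_free (?G n)" for n
    using c by (intro triangle_free_colour_graph) (auto simp: admissible_def)
  moreover have "hajnal_mate (?G n)" for n
    unfolding hajnal_mate_def lower_nbhd_colour_graph
    using union c by (auto simp: admissible_def)
  moreover have "uncountable_chromatic_number (?G n)" for n
    unfolding uncountable_chromatic_number_iff
  proof
    assume "\<exists>f :: omega1 \<Rightarrow> nat. proper_colouring (?G n) f"
    then obtain f :: "omega1 \<Rightarrow> nat" where f: "proper_colouring (?G n) f" by blast
    obtain \<alpha> \<beta> where "\<beta> < \<alpha>" "c \<alpha> \<beta> = n" "f \<alpha> = f \<beta>"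
      using not_proper_if_admissible[OF p A c] by blast
    then have "{\<beta>, \<alpha>} \<in> ?G n" "f \<beta> = f \<alpha>" "\<beta> \<noteq> \<alpha>"
      by (auto simp: doubleton_in_colour_graph_iff)
    with f show False
      unfolding proper_colouring_def by blast
  qed
  ultimately show ?thesis by blast
qed

end
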